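(* Let $A,B\in\mathcal{H}_n(\Gamma)$ have the same graph $G$ (that is, $G_A=G_B=G$). If $\Re_A(C)\le\Re_B(C)$ for each cycle $C$ in $G$, then $A$ and $B$ are cospectral if and only if $\Re_A(C)=\Re_B(C)$ for each cycle $C$ in $G$.
   Context: $\Gamma\subset\mathbb{C}$ is a set such that $0\in\Gamma$ and $\Gamma\setminus\{0\}$ is a subgroup of the multiplicative group of complex numbers of unit modulus. $\mathcal{H}_n(\Gamma)$ is the set of all $n\times n$ Hermitian matrices with entries in $\Gamma$ and zero diagonal. For $A=[a_{uv}]\in\mathcal{H}_n(\Gamma)$, the graph $G_A$ of $A$ is the simple undirected graph with vertex set $\{1,\dots,n\}$ in which $u,v$ are adjacent iff $a_{uv}\neq 0$. For a cycle $C=u_1u_2\ldots u_ku_1$ in $G_A$, the gain of $C$ is $\zeta_A(C)=a_{u_1u_2}a_{u_2u_3}\cdots a_{u_{k-1}u_k}a_{u_ku_1}$, and $\Re_A(C)$ denotes the real part of $\zeta_A(C)$ (it does not depend on the starting vertex or direction of $C$). Two matrices are cospectral if they have the same multiset of eigenvalues. *)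

theory Defs
  imports
    Complex_Main
    "HOL-Algebra.Group"
    "HOL-Computational_Algebra.Fundamental_Theorem_Algebra"
    "Jordan_Normal_Form.Char_Poly"
    "Jordan_Normal_Form.Schur_Decomposition"
    "Graph_Theory.Pair_Digraph"
begin

definition circle_group :: "complex monoid" where
  "circle_group = \<lparr>carrier = {z. cmod z = 1}, monoid.mult = (*), one = 1\<rparr>"

lemma circle_group_simps [simp]:
  "carrier circle_group = {z. cmod z = 1}"
  "x \<otimes>\<^bsub>circle_group\<^esub> y = x * y"
  "\<one>\<^bsub>circle_group\<^esub> = 1"
  by (simp_all add: circle_group_def)

lemma comm_group_circle_group: "comm_group circle_group"
proof (rule comm_groupI)
  fix x assume "x \<in> carrier circle_group"
  then have "cnj x \<in> carrier circle_group" "cnj x * x = 1"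
    using complex_norm_square[of x] by (simp_all add: mult.commute)
  then show "\<exists>y\<in>carrier circle_group. y \<otimes>\<^bsub>circle_group\<^esub> x = \<one>\<^bsub>circle_group\<^esub>"
    by (intro bexI[of _ "cnj x"]) simp_all
qed (simp_all add: norm_mult)

definition gain_set :: "complex set \<Rightarrow> bool" where
  "gain_set \<Gamma> \<longleftrightarrow> 0 \<in> \<Gamma> \<and> subgroup (\<Gamma> - {0}) circle_group"

definition hermitian_mat :: "complex mat \<Rightarrow> bool" where
  "hermitian_mat A \<longleftrightarrow> mat_adjoint A = A"

lemma hermitian_mat_iff:
  assumes "A \<in> carrier_mat n n"
  shows "hermitian_mat A \<longleftrightarrow> (\<forall>u<n. \<forall>v<n. A $$ (u, v) = cnj (A $$ (v, u)))"
proof -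
  have entry: "mat_adjoint A $$ (u, v) = cnj (A $$ (v, u))" if "u < n" "v < n" for u v
    using assms that by (simp add: mat_adjoint_def mat_of_rows_index)
  have dim: "dim_row (mat_adjoint A) = n" "dim_col (mat_adjoint A) = n"
    using assms by (simp_all add: mat_adjoint_def)
  have "mat_adjoint A = A \<longleftrightarrow> (\<forall>u<n. \<forall>v<n. mat_adjoint A $$ (u, v) = A $$ (u, v))"
    unfolding mat_eq_iff using assms dim by simp
  also have "\<dots> \<longleftrightarrow> (\<forall>u<n. \<forall>v<n. A $$ (u, v) = cnj (A $$ (v, u)))"
    using entry by metis
  finally show ?thesis
    unfolding hermitian_mat_def .
qed

text \<open>The set \<open>\<H>\<^sub>n(\<Gamma>)\<close>.  Rows and columns are indexed by \<open>0, \<dots>, n - 1\<close>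
  instead of \<open>1, \<dots>, n\<close>.\<close>

definition herm_gain_mats :: "nat \<Rightarrow> complex set \<Rightarrow> complex mat set" where
  "herm_gain_mats n \<Gamma> = {A \<in> carrier_mat n n. hermitian_mat A \<and>
     (\<forall>u<n. \<forall>v<n. A $$ (u, v) \<in> \<Gamma>) \<and> (\<forall>u<n. A $$ (u, u) = 0)}"

text \<open>As usual in \<^theory>\<open>Graph_Theory.Pair_Digraph\<close>, an undirected edge between \<open>u\<close> and \<open>v\<close> is
  the pair of arcs \<open>(u, v)\<close> and \<open>(v, u)\<close>.\<close>

definition graph_of_mat :: "complex mat \<Rightarrow> nat pair_pre_digraph" where
  "graph_of_mat A = \<lparr>pverts = {0..<dim_row A},
     parcs = {(u, v). u < dim_row A \<and> v < dim_row A \<and> A $$ (u, v) \<noteq> 0}\<rparr>"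

lemma pair_graph_graph_of_mat:
  assumes "A \<in> herm_gain_mats n \<Gamma>"
  shows "pair_graph (graph_of_mat A)"
proof -
  have A: "A \<in> carrier_mat n n" "dim_row A = n"
    and "hermitian_mat A"
    and diag: "\<And>u. u < n \<Longrightarrow> A $$ (u, u) = 0"
    using assms by (auto simp: herm_gain_mats_def)
  then have sym: "A $$ (v, u) \<noteq> 0" if "u < n" "v < n" "A $$ (u, v) \<noteq> 0" for u v
    using hermitian_mat_iff[of A n] that by (metis complex_cnj_zero)
  have fin: "finite {(u, v). u < n \<and> v < n \<and> A $$ (u, v) \<noteq> 0}"
    by (rule finite_subset[of _ "{..<n} \<times> {..<n}"]) auto
  have "sym {(u, v). u < n \<and> v < n \<and> A $$ (u, v) \<noteq> 0}"
    by (rule symI) (use sym in blast)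
  then show ?thesis
    using fin diag
    by unfold_locales (auto simp: graph_of_mat_def A(2) symmetric_def)
qed

text \<open>A cycle \<open>u\<^sub>1 u\<^sub>2 \<dots> u\<^sub>k u\<^sub>1\<close> is represented by its list of arcs
  \<open>[(u\<^sub>1, u\<^sub>2), \<dots>, (u\<^sub>k, u\<^sub>1)]\<close>.  The notion \<^const>\<open>pre_digraph.cycle\<close> is the directed one, which
  also admits \<open>[(u, v), (v, u)]\<close>; a cycle of a simple undirected graph has at least three edges.
  Each undirected cycle occurs once for each choice of starting vertex and direction.\<close>

definition ucycle :: "nat pair_pre_digraph \<Rightarrow> (nat \<times> nat) list \<Rightarrow> bool" where
  "ucycle G C \<longleftrightarrow> pre_digraph.cycle (with_proj G) C \<and> 3 \<le> length C"

definition cycle_gain :: "complex mat \<Rightarrow> (nat \<times> nat) list \<Rightarrow> complex" where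
  "cycle_gain A C = (\<Prod>(u, v)\<leftarrow>C. A $$ (u, v))"

definition re_gain :: "complex mat \<Rightarrow> (nat \<times> nat) list \<Rightarrow> real" where
  "re_gain A C = Re (cycle_gain A C)"

text \<open>Eigenvalues are counted with their algebraic multiplicity, which for Hermitian matrices
  agrees with the geometric one.\<close>

definition eigenvalue_mset :: "complex mat \<Rightarrow> complex multiset" where
  "eigenvalue_mset A = proots (char_poly A)"

definition cospectral :: "complex mat \<Rightarrow> complex mat \<Rightarrow> bool" where
  "cospectral A B \<longleftrightarrow> eigenvalue_mset A = eigenvalue_mset B"

lemma pcas_imp_zip_rotate1:
  assumes "pcas u p v" "p \<noteq> []"
  shows "p = zip (map fst p) (tl (map fst p) @ [v]) \<and> fst (hd p) = u"
  using assms
proof (induction p arbitrary: u)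
  case (Cons e p)
  then show ?case by (cases p; cases e) auto
qed simp

lemma pcas_zip: "us \<noteq> [] \<Longrightarrow> pcas (hd us) (zip us (tl us @ [v])) v"
proof (induction us)
  case (Cons u us)
  then show ?case by (cases us) auto
qed simp

lemma pawalk_verts_zip:
  "us \<noteq> [] \<Longrightarrow> pawalk_verts (hd us) (zip us (tl us @ [v])) = us @ [v]"
proof (induction us)
  case (Cons u us)
  then show ?case by (cases us) auto
qed simp

lemma ucycle_iff:
  assumes "A \<in> herm_gain_mats n \<Gamma>"
  shows "ucycle (graph_of_mat A) C \<longleftrightarrow>
    (\<exists>us. C = zip us (rotate1 us) \<and> distinct us \<and> 3 \<le> length us \<and>
      (\<forall>(u, v)\<in>set C. u < n \<and> v < n \<and> A $$ (u, v) \<noteq> 0))"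
    (is "?L \<longleftrightarrow> ?R")
proof -
  interpret pair_graph "graph_of_mat A"
    using assms by (rule pair_graph_graph_of_mat)
  have dim: "dim_row A = n"
    using assms by (auto simp: herm_gain_mats_def)
  have arcs: "set C \<subseteq> parcs (graph_of_mat A) \<longleftrightarrow>
      (\<forall>(u, v)\<in>set C. u < n \<and> v < n \<and> A $$ (u, v) \<noteq> 0)"
    by (auto simp: graph_of_mat_def dim)
  have rot: "tl us @ [hd us] = rotate1 us" if "us \<noteq> []" for us :: "nat list"
    using that by (cases us) auto
  show ?thesis
  proof
    assume ?L
    then obtain u where u: "awalk u C u" "distinct (tl (pawalk_verts u C))" "3 \<le> length C"
      unfolding ucycle_def cycle_def by auto
    define us where "us = map fst C"
    have ne: "C \<noteq> []" "us \<noteq> []" using u(3) by (auto simp: us_def)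
    from u(1) have "pcas u C u" "set C \<subseteq> parcs (graph_of_mat A)"
      by (simp_all add: awalk_def)
    with pcas_imp_zip_rotate1[of u C u] ne
    have C: "C = zip us (tl us @ [u])" and hd: "hd us = u"
      by (auto simp: us_def hd_map)
    from pawalk_verts_zip[OF ne(2), of u] have "pawalk_verts u C = us @ [u]"
      by (simp add: hd flip: C)
    with u(2) have "distinct (tl us @ [u])" using ne by simp
    then have "distinct us" using ne hd by (cases us) auto
    moreover have "C = zip us (rotate1 us)"
      using rot[OF ne(2)] C hd by simp
    moreover have "3 \<le> length us" using u(3) by (simp add: us_def)
    ultimately show ?R
      using arcs \<open>set C \<subseteq> _\<close> by blast
  next
    assume ?R
    then obtain us where us: "C = zip us (rotate1 us)" "distinct us" "3 \<le> length us"
      and "set C \<subseteq> parcs (graph_of_mat A)"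
      using arcs by blast
    have ne: "us \<noteq> []" using us(3) by auto
    then have C: "C = zip us (tl us @ [hd us])" using rot us(1) by simp
    have len: "length C = length us" using us(1) by simp
    then obtain e C' where e: "C = e # C'" using ne by (cases C) auto
    have "pcas (hd us) C (hd us)" using pcas_zip[OF ne, of "hd us"] C by simp
    moreover from this have "hd us = fst e" using e by simp
    then have "hd us \<in> pverts (graph_of_mat A)"
      using e \<open>set C \<subseteq> _\<close> arc_fst_in_verts by auto
    ultimately have "awalk (hd us) C (hd us)"
      using \<open>set C \<subseteq> _\<close> by (simp add: awalk_def)
    moreover have "pawalk_verts (hd us) C = us @ [hd us]"
      using pawalk_verts_zip[OF ne, of "hd us"] C by simp
    then have "tl (pawalk_verts (hd us) C) = rotate1 us"
      using rot ne by simp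
    then have "distinct (tl (pawalk_verts (hd us) C))"
      using us(2) by simp
    ultimately show ?L
      unfolding ucycle_def cycle_def using us(3) len e by auto
  qed
qed

end

theory Submission
  imports Defs "HOL-Combinatorics.Cycles" "HOL-Combinatorics.Orbits"
begin

text \<open>
  The coefficients of the characteristic polynomial are, up to sign, the sums \<open>E\<^sub>k\<close> of all \<open>k \<times> k\<close>
  principal minors, so cospectrality says that \<open>E\<^sub>k(A) = E\<^sub>k(B)\<close> for every \<open>k\<close>.  A principal
  minor on an index set \<open>S\<close> is a signed sum over the permutations of \<open>S\<close>.  Choose \<open>m \<in> S\<close> and split
  each permutation into its cycle through \<open>m\<close>, with underlying set \<open>T\<close>, and a permutation of
  \<open>S - T\<close>.  This expresses the minor through smaller minors (\<open>principal_minor_cycle_expansion\<close>),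
  with coefficients \<open>cycle_sum\<close> that collect all cyclic permutations of \<open>T\<close>.  For a Hermitian
  matrix a cycle and its inverse have conjugate weights, and therefore \<open>cycle_sum\<close> is the sum of
  the \<^emph>\<open>real parts\<close> of the weights, times a sign that depends on \<open>card T\<close> only
  (\<open>cycle_sum_hermitian\<close>).  Thus every principal minor is determined by real parts of cycle gains,
  which shows that equal real parts imply cospectrality.

  For the converse, let all real parts agree on cycles with fewer than \<open>k\<close> vertices.  The
  expansion shows that for a set \<open>S\<close> with \<open>k\<close> elements the minors of \<open>A\<close> and \<open>B\<close> differ by the
  contribution of the cycles that run through all of \<open>S\<close> (\<open>principal_minor_diff\<close>).  Summing over
  all such \<open>S\<close>, the equation \<open>E\<^sub>k(A) = E\<^sub>k(B)\<close> says that differences of real parts, all of the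
  same sign by hypothesis, add up to \<open>0\<close>.  Hence each of them vanishes, and induction on \<open>k\<close>
  applies (\<open>sums_of_principal_minors_eq_iff\<close>).

  A cyclic permutation of at least three vertices with nonzero weight is a cycle of the graph.
  The remaining cyclic permutations have the same weight for both matrices: a weight is zero for
  both if the permutation leaves the common graph, and a 2-cycle \<open>u v\<close> along an edge contributes
  \<open>\<bar>a\<^sub>u\<^sub>v\<bar>\<^sup>2 = 1\<close>.
\<close>

section \<open>Cyclic permutations\<close>

text \<open>The empty set has no cyclic permutation, while a singleton has exactly one, the identity:
  fixed points count as cycles of length one.\<close>

definition cyclic_perms :: "'a set \<Rightarrow> ('a \<Rightarrow> 'a) set" where
  "cyclic_perms T = {c. c permutes T \<and> cyclic_on c T}"

lemma cyclic_perms_permutes: "c \<in> cyclic_perms T \<Longrightarrow> c permutes T"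
  by (simp add: cyclic_perms_def)

lemma finite_cyclic_perms: "finite T \<Longrightarrow> finite (cyclic_perms T)"
  unfolding cyclic_perms_def by (rule finite_subset[OF _ finite_permutations]) auto

lemma permutation_permutesI: "p permutes S \<Longrightarrow> finite S \<Longrightarrow> permutation p"
  by (auto simp: permutation_permutes)

text \<open>Cyclic permutations serve the algebra of determinants, and lists of distinct vertices
  describe the cycles of a graph.  The next two lemmas translate between them.\<close>

lemma cycle_of_list_in_cyclic_perms:
  assumes "distinct us" "us \<noteq> []"
  shows "cycle_of_list us \<in> cyclic_perms (set us)"
proof -
  let ?c = "cycle_of_list us" and ?k = "length us"
  have pow: "(?c ^^ n) (us ! 0) = us ! (n mod ?k)" for n
  proof -
    have "(?c ^^ n) (us ! 0) = map (?c ^^ n) us ! 0"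
      using assms by simp
    also have "\<dots> = us ! (n mod ?k)"
      using assms by (simp add: cyclic_rotation nth_rotate)
    finally show ?thesis .
  qed
  have "orbit ?c (us ! 0) = {(?c ^^ n) (us ! 0) | n. True}"
    by (rule orbit_altdef_permutation[OF permutation_of_cycle])
  also have "\<dots> = set us"
  proof (intro Set.set_eqI iffI)
    fix x assume "x \<in> {(?c ^^ n) (us ! 0) | n. True}"
    then show "x \<in> set us" using assms by (auto simp: pow)
  next
    fix x assume "x \<in> set us"
    then obtain i where "i < ?k" "x = us ! i" by (auto simp: in_set_conv_nth)
    then have "x = (?c ^^ i) (us ! 0)" by (simp add: pow)
    then show "x \<in> {(?c ^^ n) (us ! 0) | n. True}" by blast
  qed
  finally have "cyclic_on ?c (set us)"
    using assms by (intro cyclic_on_singleI[of "us ! 0"]) auto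
  then show ?thesis
    by (simp add: cyclic_perms_def cycle_permutes)
qed

lemma cyclic_permsE:
  assumes "c \<in> cyclic_perms T" "finite T"
  obtains us where "distinct us" "set us = T" "c = cycle_of_list us"
proof -
  have c: "c permutes T" "permutation c" "cyclic_on c T"
    using assms by (auto simp: cyclic_perms_def intro: permutation_permutesI)
  then obtain s where s: "s \<in> T" "T = orbit c s" by (auto simp: cyclic_on_def)
  define us where "us = support c s"
  have set: "set us = T"
    unfolding us_def support_set[OF c(2)] s(2) orbit_altdef_permutation[OF c(2)] by auto
  moreover have "distinct us"
    unfolding us_def by (rule cycle_of_permutation[OF c(2)])
  moreover have "c = cycle_of_list us"
  proof
    fix x
    show "c x = cycle_of_list us x"
    proof (cases "x \<in> T")
      case True
      then show ?thesis using cycle_restrict[OF c(2)] set unfolding us_def by blast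
    next
      case False
      then show ?thesis using c(1) set by (simp add: permutes_not_in id_outside_supp)
    qed
  qed
  ultimately show thesis using that by blast
qed

lemma sign_cycle_of_list:
  "distinct us \<Longrightarrow> us \<noteq> [] \<Longrightarrow> sign (cycle_of_list us) = - ((- 1) ^ length us)"
proof (induction us rule: cycle_of_list.induct)
  case (1 i j cs)
  have "sign (cycle_of_list (i # j # cs)) = sign (transpose i j) * sign (cycle_of_list (j # cs))"
    unfolding cycle_of_list.simps by (rule sign_compose[OF permutation_swap_id permutation_of_cycle])
  moreover have "sign (transpose i j) = - 1"
    using 1 by (simp add: sign_swap_id)
  moreover have "sign (cycle_of_list (j # cs)) = - ((- 1) ^ length (j # cs))"
    using 1 by simp
  ultimately show ?case
    by (simp only: length_Cons power_Suc mult_minus_left mult_1 minus_minus)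
next
  case "2_1"
  then show ?case by simp
next
  case ("2_2" v)
  then show ?case by simp
qed

lemma sign_cyclic_perm:
  assumes "c \<in> cyclic_perms T" "finite T"
  shows "sign c = - ((- 1) ^ card T)"
proof -
  obtain us where us: "distinct us" "set us = T" "c = cycle_of_list us"
    using cyclic_permsE[OF assms] .
  have "us \<noteq> []" using assms us(2) by (auto simp: cyclic_perms_def cyclic_on_def)
  then show ?thesis using sign_cycle_of_list[of us] us distinct_card by fastforce
qed

lemma inv_in_cyclic_perms:
  assumes "c \<in> cyclic_perms T" "finite T"
  shows "Hilbert_Choice.inv c \<in> cyclic_perms T"
proof -
  have c: "c permutes T" "cyclic_on c T" using assms(1) by (auto simp: cyclic_perms_def)
  have "orbit (Hilbert_Choice.inv c) x = orbit c x" for x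
    by (rule orbit_inv_eq[OF permutation_permutesI[OF c(1) assms(2)]])
  then show ?thesis
    using c by (simp add: cyclic_perms_def cyclic_on_def Permutations.permutes_inv)
qed

lemma perm_restrict_invariant:
  assumes "f permutes S" "f ` A \<subseteq> A" "finite A"
  shows "perm_restrict f A permutes A"
proof (rule bij_imp_permutes)
  have inj: "inj_on f A" using assms(1) permutes_inj by (blast intro: inj_on_subset)
  then have "f ` A = A" using assms endo_inj_surj by blast
  with inj have "bij_betw f A A" by (simp add: bij_betw_def)
  then show "bij_betw (perm_restrict f A) A A"
    by (rule bij_betw_cong[THEN iffD1, rotated]) (simp add: perm_restrict_simps)
qed (simp add: perm_restrict_simps)

section \<open>Expanding principal minors along a cycle\<close>

definition principal_minor :: "('a \<Rightarrow> 'a \<Rightarrow> complex) \<Rightarrow> 'a set \<Rightarrow> complex" where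
  "principal_minor a S = (\<Sum>p | p permutes S. of_int (sign p) * (\<Prod>i\<in>S. a i (p i)))"

definition cycle_sum :: "('a \<Rightarrow> 'a \<Rightarrow> complex) \<Rightarrow> 'a set \<Rightarrow> complex" where
  "cycle_sum a T = (\<Sum>c\<in>cyclic_perms T. of_int (sign c) * (\<Prod>i\<in>T. a i (c i)))"

lemma principal_minor_empty [simp]: "principal_minor a {} = 1"
  by (simp add: principal_minor_def)

text \<open>A permutation \<open>p\<close> of \<open>S\<close> corresponds to the triple of the orbit \<open>T\<close> of \<open>m\<close>, the
  restriction of \<open>p\<close> to \<open>T\<close>, which is cyclic, and the restriction of \<open>p\<close> to \<open>S - T\<close>, which is
  arbitrary.  Both signs and weights are multiplicative under this decomposition.\<close>

lemma principal_minor_cycle_expansion: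
  assumes fin: "finite S" and m: "m \<in> S"
  shows "principal_minor a S =
    (\<Sum>T | m \<in> T \<and> T \<subseteq> S. cycle_sum a T * principal_minor a (S - T))"
proof -
  let ?I = "{T. m \<in> T \<and> T \<subseteq> S}"
  let ?Q = "\<lambda>T. cyclic_perms T \<times> {q. q permutes (S - T)}"
  let ?f = "\<lambda>p S. of_int (sign p) * (\<Prod>i\<in>S. a i (p i)) :: complex"
  define h where "h = (\<lambda>(T, c, q). ?f c T * ?f q (S - T))"
  have finI: "finite ?I" using fin by auto
  have finQ: "finite (?Q T)" if "T \<in> ?I" for T
    using that fin by (intro finite_cartesian_product finite_cyclic_perms finite_permutations)
      (auto dest: finite_subset)
  have "(\<Sum>T\<in>?I. cycle_sum a T * principal_minor a (S - T)) = (\<Sum>T\<in>?I. \<Sum>x\<in>?Q T. h (T, x))"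
    by (simp add: cycle_sum_def principal_minor_def sum_product sum.cartesian_product h_def
        case_prod_unfold)
  also have "\<dots> = sum h (Sigma ?I ?Q)"
    using finI finQ by (subst sum.Sigma) auto
  also have "\<dots> = (\<Sum>p | p permutes S. ?f p S)"
  proof (rule sum.reindex_bij_witness[symmetric, where
        i = "\<lambda>(T, c, q). c \<circ> q" and
        j = "\<lambda>p. (orbit p m, perm_restrict p (orbit p m), perm_restrict p (S - orbit p m))"])
    fix p assume "p \<in> {p. p permutes S}"
    then have p: "p permutes S" by simp
    define T where "T = orbit p m"
    have perm: "permutation p" using p fin by (rule permutation_permutesI)
    have TS: "T \<subseteq> S" unfolding T_def using permutes_orbit_subset[OF p m] .
    have mT: "m \<in> T" unfolding T_def by (rule permutation_self_in_orbit[OF perm])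
    have finT: "finite T" using TS fin by (rule finite_subset)
    have cyc: "cyclic_on p T" unfolding T_def by (rule cyclic_on_orbit[OF p fin])
    have c: "perm_restrict p T permutes T"
      using p cyc finT by (intro perm_restrict_invariant[of p S]) (auto intro: cyclic_on_inI)
    have q: "perm_restrict p (S - T) permutes (S - T)"
      by (rule perm_restrict_diff_cyclic[OF p cyc])
    have un: "T \<union> (S - T) = S" using TS by auto
    have comp: "perm_restrict p T \<circ> perm_restrict p (S - T) = p"
      using perm_restrict_union[OF c q] un p by auto
    show "(case (orbit p m, perm_restrict p (orbit p m), perm_restrict p (S - orbit p m))
       of (T, c, q) \<Rightarrow> c \<circ> q) = p"
      using comp by (simp add: T_def)
    show "(orbit p m, perm_restrict p (orbit p m), perm_restrict p (S - orbit p m)) \<in> Sigma ?I ?Q"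
      using c q TS mT cyc
      by (simp add: cyclic_perms_def cyclic_on_perm_restrict T_def)
    have "sign p = sign (perm_restrict p T) * sign (perm_restrict p (S - T))"
      by (subst comp[symmetric], rule sign_compose)
        (use c q finT fin in \<open>auto intro: permutation_permutesI\<close>)
    moreover have "(\<Prod>i\<in>S. a i (p i)) =
        (\<Prod>i\<in>T. a i (perm_restrict p T i)) * (\<Prod>i\<in>S - T. a i (perm_restrict p (S - T) i))"
      using prod.subset_diff[OF TS fin, of "\<lambda>i. a i (p i)"]
      by (simp add: perm_restrict_simps mult.commute)
    ultimately show "h (orbit p m, perm_restrict p (orbit p m), perm_restrict p (S - orbit p m))
        = ?f p S"
      by (simp add: h_def T_def)
  next
    fix x assume "x \<in> Sigma ?I ?Q"
    then obtain T c q where x: "x = (T, c, q)" and T: "m \<in> T" "T \<subseteq> S"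
      and c: "c permutes T" "cyclic_on c T" and q: "q permutes (S - T)"
      by (auto simp: cyclic_perms_def)
    have "cyclic_on (c \<circ> q) T"
      using q c(2) by (rule permutes_comp_preserves_cyclic1[where A = T]) auto
    then have orb: "orbit (c \<circ> q) m = T" using T(1) by (rule orbit_cyclic_eq3)
    have "perm_restrict (c \<circ> q) T = c"
      using c q by (auto simp: fun_eq_iff perm_restrict_def permutes_not_in)
    moreover have "perm_restrict (c \<circ> q) (S - T) = q"
    proof
      fix y
      have "q y \<in> S - T" if "y \<in> S - T" using q that by (simp only: permutes_in_image)
      then show "perm_restrict (c \<circ> q) (S - T) y = q y"
        using c(1) q by (auto simp: perm_restrict_def permutes_not_in)
    qed
    ultimately show "(\<lambda>p. (orbit p m, perm_restrict p (orbit p m), perm_restrict p (S - orbit p m)))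
       (case x of (T, c, q) \<Rightarrow> c \<circ> q) = x"
      by (simp add: x orb)
    have "c permutes S" "q permutes S"
      using c(1) q T(2) by (auto intro: permutes_subset)
    then show "(case x of (T, c, q) \<Rightarrow> c \<circ> q) \<in> {p. p permutes S}"
      by (simp add: x permutes_compose)
  qed
  finally show ?thesis by (simp add: principal_minor_def)
qed

lemma principal_minor_cong:
  assumes "finite S" and "\<And>T. T \<subseteq> S \<Longrightarrow> T \<noteq> {} \<Longrightarrow> cycle_sum a T = cycle_sum b T"
  shows "principal_minor a S = principal_minor b S"
  using assms
proof (induction S rule: finite_psubset_induct)
  case (psubset S)
  show ?case
  proof (cases "S = {}")
    case False
    then obtain m where m: "m \<in> S" by blast
    have "cycle_sum a T * principal_minor a (S - T) = cycle_sum b T * principal_minor b (S - T)"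
      if "m \<in> T \<and> T \<subseteq> S" for T
    proof -
      have "S - T \<subset> S" using that by auto
      then have "principal_minor a (S - T) = principal_minor b (S - T)"
        by (rule psubset.IH) (use psubset.prems in auto)
      moreover have "cycle_sum a T = cycle_sum b T" using that by (intro psubset.prems) auto
      ultimately show ?thesis by simp
    qed
    then show ?thesis
      unfolding principal_minor_cycle_expansion[OF psubset.hyps m] by (intro sum.cong) auto
  qed simp
qed

text \<open>In the cycle expansion only the summand \<open>T = S\<close> involves cycles through all of \<open>S\<close>; there the
  remaining minor is the empty one, which equals \<open>1\<close>.\<close>

lemma principal_minor_diff:
  assumes fin: "finite S" and ne: "S \<noteq> {}"
    and eq: "\<And>T. T \<subset> S \<Longrightarrow> T \<noteq> {} \<Longrightarrow> cycle_sum a T = cycle_sum b T"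
  shows "principal_minor a S - principal_minor b S = cycle_sum a S - cycle_sum b S"
proof -
  obtain m where m: "m \<in> S" using ne by blast
  let ?I = "{T. m \<in> T \<and> T \<subseteq> S}"
  have finI: "finite ?I" and SI: "S \<in> ?I" using fin m by auto
  have "cycle_sum a T * principal_minor a (S - T) = cycle_sum b T * principal_minor b (S - T)"
    if "T \<in> ?I - {S}" for T
  proof -
    have "principal_minor a (S - T) = principal_minor b (S - T)"
      using that fin by (intro principal_minor_cong eq) auto
    moreover have "cycle_sum a T = cycle_sum b T" using that by (intro eq) auto
    ultimately show ?thesis by simp
  qed
  then have "(\<Sum>T\<in>?I - {S}. cycle_sum a T * principal_minor a (S - T)) =
      (\<Sum>T\<in>?I - {S}. cycle_sum b T * principal_minor b (S - T))"
    by (intro sum.cong) auto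
  then show ?thesis
    unfolding principal_minor_cycle_expansion[OF fin m] sum.remove[OF finI SI] by simp
qed

section \<open>Hermitian weights\<close>

definition cycle_re :: "('a \<Rightarrow> 'a \<Rightarrow> complex) \<Rightarrow> 'a set \<Rightarrow> ('a \<Rightarrow> 'a) \<Rightarrow> real" where
  "cycle_re a T c = Re (\<Prod>i\<in>T. a i (c i))"

text \<open>Inversion is an involution on the cyclic permutations of \<open>T\<close>, and by the Hermitian symmetry it
  conjugates the weight.  The imaginary parts therefore cancel, even though the individual weights
  need not be real.  All cyclic permutations of \<open>T\<close> have the same sign.\<close>

lemma cycle_sum_hermitian:
  assumes fin: "finite T" and herm: "\<And>i j. i \<in> T \<Longrightarrow> j \<in> T \<Longrightarrow> a i j = cnj (a j i)"
  shows "cycle_sum a T = of_real (- ((- 1) ^ card T) * (\<Sum>c\<in>cyclic_perms T. cycle_re a T c))"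
proof -
  let ?w = "\<lambda>c. \<Prod>i\<in>T. a i (c i)"
  have inv_weight: "?w (Hilbert_Choice.inv c) = cnj (?w c)" if "c \<in> cyclic_perms T" for c
  proof -
    have c: "c permutes T" using that by (simp add: cyclic_perms_def)
    have "?w (Hilbert_Choice.inv c) = (\<Prod>i\<in>T. a (c i) i)"
      using prod.permute[OF c, of "\<lambda>i. a i (Hilbert_Choice.inv c i)"] permutes_inverses(2)[OF c] by simp
    also have "\<dots> = (\<Prod>i\<in>T. cnj (a i (c i)))"
      using c by (intro prod.cong herm) (auto simp: permutes_in_image)
    finally show ?thesis by simp
  qed
  have "(\<Sum>c\<in>cyclic_perms T. ?w c) = (\<Sum>c\<in>cyclic_perms T. ?w (Hilbert_Choice.inv c))"
    by (rule sum.reindex_bij_witness[where i = Hilbert_Choice.inv and j = Hilbert_Choice.inv])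
      (use fin in \<open>auto simp: inv_in_cyclic_perms permutes_inv_inv dest: cyclic_perms_permutes\<close>)
  also have "\<dots> = cnj (\<Sum>c\<in>cyclic_perms T. ?w c)"
    by (simp add: inv_weight)
  finally have "(\<Sum>c\<in>cyclic_perms T. ?w c) \<in> \<real>"
    by (rule Reals_cnj_iff[THEN iffD2, OF sym])
  then have "(\<Sum>c\<in>cyclic_perms T. ?w c) = of_real (Re (\<Sum>c\<in>cyclic_perms T. ?w c))"
    by (rule of_real_Re[symmetric])
  also have "Re (\<Sum>c\<in>cyclic_perms T. ?w c) = (\<Sum>c\<in>cyclic_perms T. cycle_re a T c)"
    unfolding cycle_re_def by (rule Re_sum)
  finally have real: "(\<Sum>c\<in>cyclic_perms T. ?w c) = of_real (\<Sum>c\<in>cyclic_perms T. cycle_re a T c)" .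
  have "cycle_sum a T = (\<Sum>c\<in>cyclic_perms T. - ((- 1) ^ card T) * ?w c)"
    unfolding cycle_sum_def by (intro sum.cong) (auto simp: sign_cyclic_perm fin)
  also have "\<dots> = - ((- 1) ^ card T) * (\<Sum>c\<in>cyclic_perms T. ?w c)"
    by (rule sum_distrib_left[symmetric])
  finally show ?thesis unfolding real by simp
qed

text \<open>The combinatorial core of the theorem.  The direction from minors to cycles is an induction on
  the number of vertices of the cycle.\<close>

lemma sums_of_principal_minors_eq_iff:
  assumes fin: "finite U"
    and a: "\<And>i j. i \<in> U \<Longrightarrow> j \<in> U \<Longrightarrow> a i j = cnj (a j i)"
    and b: "\<And>i j. i \<in> U \<Longrightarrow> j \<in> U \<Longrightarrow> b i j = cnj (b j i)"
    and le: "\<And>T c. T \<subseteq> U \<Longrightarrow> c \<in> cyclic_perms T \<Longrightarrow> cycle_re a T c \<le> cycle_re b T c"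
  shows "(\<forall>k. (\<Sum>S | S \<subseteq> U \<and> card S = k. principal_minor a S) =
              (\<Sum>S | S \<subseteq> U \<and> card S = k. principal_minor b S)) \<longleftrightarrow>
    (\<forall>T\<subseteq>U. \<forall>c\<in>cyclic_perms T. cycle_re a T c = cycle_re b T c)"
    (is "?minors \<longleftrightarrow> ?cycles")
proof
  have finU: "finite T" if "T \<subseteq> U" for T using that fin by (rule finite_subset)
  have cycle_sum_a: "cycle_sum a T =
      of_real (- ((- 1) ^ card T) * (\<Sum>c\<in>cyclic_perms T. cycle_re a T c))" if "T \<subseteq> U" for T
    by (rule cycle_sum_hermitian[OF finU[OF that]], rule a) (use that in blast)+
  have cycle_sum_b: "cycle_sum b T =
      of_real (- ((- 1) ^ card T) * (\<Sum>c\<in>cyclic_perms T. cycle_re b T c))" if "T \<subseteq> U" for T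
    by (rule cycle_sum_hermitian[OF finU[OF that]], rule b) (use that in blast)+
  show ?minors if cyc: ?cycles
  proof
    fix k
    have "cycle_sum a T = cycle_sum b T" if "T \<subseteq> U" for T
    proof -
      have "(\<Sum>c\<in>cyclic_perms T. cycle_re a T c) = (\<Sum>c\<in>cyclic_perms T. cycle_re b T c)"
        using cyc that by (intro sum.cong) blast+
      then show ?thesis unfolding cycle_sum_a[OF that] cycle_sum_b[OF that] by (simp only:)
    qed
    then have "principal_minor a S = principal_minor b S" if "S \<subseteq> U" for S
      using that by (intro principal_minor_cong finU) blast+
    then show "(\<Sum>S | S \<subseteq> U \<and> card S = k. principal_minor a S) =
        (\<Sum>S | S \<subseteq> U \<and> card S = k. principal_minor b S)"
      by (intro sum.cong) auto
  qed
  show ?cycles if minors: ?minors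
  proof (intro allI impI)
    fix T assume "T \<subseteq> U"
    then show "\<forall>c\<in>cyclic_perms T. cycle_re a T c = cycle_re b T c"
    proof (induction "card T" arbitrary: T rule: less_induct)
      case less
      define k where "k = card T"
      let ?I = "{S. S \<subseteq> U \<and> card S = k}"
      let ?D = "\<lambda>S. \<Sum>c\<in>cyclic_perms S. cycle_re b S c - cycle_re a S c"
      show ?case
      proof (cases "T = {}")
        case True
        then show ?thesis by (simp add: cyclic_perms_def cyclic_on_def)
      next
        case False
        then have "k > 0" unfolding k_def using finU[OF less.prems] by (simp add: card_gt_0_iff)
        have finI: "finite ?I" using fin by auto
        have nonneg: "0 \<le> ?D S" if "S \<in> ?I" for S
          using that le by (intro sum_nonneg) auto
        have diff: "principal_minor a S - principal_minor b S =
            of_real ((- 1) ^ k * ?D S)" if "S \<in> ?I" for S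
        proof -
          have S: "S \<subseteq> U" "card S = k" using that by auto
          have "cycle_sum a R = cycle_sum b R" if R: "R \<subset> S" for R
          proof -
            have "R \<subseteq> U" using R S by auto
            moreover have "card R < card T"
              using psubset_card_mono[OF finU[OF S(1)] R] S by (simp add: k_def)
            ultimately have "\<forall>c\<in>cyclic_perms R. cycle_re a R c = cycle_re b R c"
              using less.hyps by blast
            then have "(\<Sum>c\<in>cyclic_perms R. cycle_re a R c) = (\<Sum>c\<in>cyclic_perms R. cycle_re b R c)"
              by (intro sum.cong) blast+
            then show ?thesis
              unfolding cycle_sum_a[OF \<open>R \<subseteq> U\<close>] cycle_sum_b[OF \<open>R \<subseteq> U\<close>] by (simp only:)
          qed
          then have "principal_minor a S - principal_minor b S = cycle_sum a S - cycle_sum b S"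
            using S \<open>k > 0\<close> finU[OF S(1)] by (intro principal_minor_diff) auto
          also have "\<dots> = of_real ((- 1) ^ k * ?D S)"
            unfolding cycle_sum_a[OF S(1)] cycle_sum_b[OF S(1)] S(2)
            by (simp add: sum_subtractf algebra_simps)
          finally show ?thesis .
        qed
        \<comment> \<open>The sign in \<open>diff\<close> is the same for all \<open>S\<close> of size \<open>k\<close>, and each \<open>?D S\<close> is
          nonnegative, so nothing can cancel in the sum over \<open>S\<close>.\<close>
        have "0 = (\<Sum>S\<in>?I. principal_minor a S - principal_minor b S)"
          using minors by (simp add: sum_subtractf)
        also have "\<dots> = (\<Sum>S\<in>?I. of_real ((- 1) ^ k * ?D S))"
          by (intro sum.cong diff) auto
        also have "\<dots> = of_real ((- 1) ^ k * (\<Sum>S\<in>?I. ?D S))"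
          by (simp add: sum_distrib_left)
        finally have "(- 1) ^ k * (\<Sum>S\<in>?I. ?D S) = 0"
          by (rule of_real_eq_0_iff[THEN iffD1, OF sym])
        then have "(\<Sum>S\<in>?I. ?D S) = 0" by simp
        then have "?D T = 0"
          using sum_nonneg_eq_0_iff[OF finI nonneg] less.prems by (simp add: k_def)
        then have "\<forall>c\<in>cyclic_perms T. cycle_re b T c - cycle_re a T c = 0"
          using le[OF less.prems] finite_cyclic_perms[OF finU[OF less.prems]]
          by (subst (asm) sum_nonneg_eq_0_iff) auto
        then show ?thesis by simp
      qed
    qed
  qed
qed

section \<open>Characteristic polynomials\<close>

text \<open>In the Leibniz formula for \<open>det (x I - A)\<close>, a permutation \<open>p\<close> selects from row \<open>i\<close> the
  constant \<open>- A $$ (i, p i)\<close>, plus \<open>x\<close> if \<open>p\<close> fixes \<open>i\<close>.  Multiplying out means to choose the set \<open>S\<close> of indices where the constant is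
  taken; the choice survives exactly for the \<open>p\<close> that fix all other indices, that is, for the
  permutations of \<open>S\<close>.\<close>

lemma char_poly_principal_minors:
  assumes A: "A \<in> carrier_mat n n"
  shows "char_poly A = (\<Sum>S\<in>Pow {0..<n}.
    monom ((- 1) ^ card S * principal_minor (\<lambda>i j. A $$ (i, j)) S) (n - card S))"
proof -
  let ?U = "{0..<n}"
  let ?P = "{p. p permutes ?U}"
  let ?x = "\<lambda>p i. if p i = i then [:0, 1:] else 0 :: complex poly"
  let ?y = "\<lambda>p i. [: - A $$ (i, p i) :]"
  have summand: "(\<Sum>p\<in>?P. of_int (sign p) * ((\<Prod>i\<in>S. ?y p i) * (\<Prod>i\<in>?U - S. ?x p i))) =
      monom ((- 1) ^ card S * principal_minor (\<lambda>i j. A $$ (i, j)) S) (n - card S)"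
    if S: "S \<subseteq> ?U" for S
  proof -
    have finS: "finite S" using S finite_subset by blast
    have sub: "{p. p permutes S} \<subseteq> ?P" using S by (auto intro: permutes_subset)
    have vanish: "(\<Prod>i\<in>?U - S. ?x p i) = 0" if "p \<in> ?P - {p. p permutes S}" for p
    proof -
      have "\<exists>i\<in>?U - S. p i \<noteq> i"
        using that permutes_superset[of p ?U S] by blast
      then show ?thesis by (auto intro!: prod_zero)
    qed
    have X: "[:0, 1:] = (monom 1 1 :: complex poly)" by (simp add: monom_altdef)
    have fixed: "(\<Prod>i\<in>?U - S. ?x p i) = monom 1 (n - card S)" if "p permutes S" for p
    proof -
      have "(\<Prod>i\<in>?U - S. ?x p i) = (\<Prod>i\<in>?U - S. [:0, 1:])"
        using that by (intro prod.cong) (auto simp: permutes_not_in)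
      also have "\<dots> = [:0, 1:] ^ card (?U - S)" by simp
      also have "card (?U - S) = n - card S" using S finS by (simp add: card_Diff_subset)
      finally show ?thesis by (simp add: X monom_power)
    qed
    have const_prod: "(\<Prod>i\<in>S. ?y p i) = [: (- 1) ^ card S * (\<Prod>i\<in>S. A $$ (i, p i)) :]" for p
      using finS by (induction S rule: finite_induct) (auto simp: algebra_simps)
    have "(\<Sum>p\<in>?P. of_int (sign p) * ((\<Prod>i\<in>S. ?y p i) * (\<Prod>i\<in>?U - S. ?x p i))) =
        (\<Sum>p | p permutes S. of_int (sign p) * ((\<Prod>i\<in>S. ?y p i) * (\<Prod>i\<in>?U - S. ?x p i)))"
      using sub vanish by (intro sum.mono_neutral_right) (auto intro: finite_permutations)
    also have "\<dots> = (\<Sum>p | p permutes S.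
        monom ((- 1) ^ card S * (of_int (sign p) * (\<Prod>i\<in>S. A $$ (i, p i)))) (n - card S))"
      by (intro sum.cong)
        (auto simp: fixed const_prod smult_monom of_int_poly mult_ac)
    also have "\<dots> = monom ((- 1) ^ card S * principal_minor (\<lambda>i j. A $$ (i, j)) S) (n - card S)"
      by (simp add: monom_sum principal_minor_def sum_distrib_left)
    finally show ?thesis .
  qed
  have entry: "char_poly_matrix A $$ (i, p i) = ?y p i + ?x p i" if "p permutes ?U" "i \<in> ?U" for p i
  proof -
    have "p i < n" using permutes_in_image[OF that(1), of i] that(2) by simp
    then show ?thesis using A that(2) by (auto simp: char_poly_matrix_def)
  qed
  have "char_poly A = (\<Sum>p\<in>?P. of_int (sign p) * (\<Prod>i\<in>?U. char_poly_matrix A $$ (i, p i)))"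
    using char_poly_matrix_closed[OF A] by (simp add: char_poly_def det_def)
  also have "\<dots> = (\<Sum>p\<in>?P. of_int (sign p) * (\<Prod>i\<in>?U. ?y p i + ?x p i))"
    by (intro sum.cong arg_cong2[where f = "(*)"] prod.cong entry) auto
  also have "\<dots> = (\<Sum>p\<in>?P. \<Sum>S\<in>Pow ?U.
      of_int (sign p) * ((\<Prod>i\<in>S. ?y p i) * (\<Prod>i\<in>?U - S. ?x p i)))"
    by (subst prod_add) (simp_all add: sum_distrib_left)
  also have "\<dots> = (\<Sum>S\<in>Pow ?U. \<Sum>p\<in>?P.
      of_int (sign p) * ((\<Prod>i\<in>S. ?y p i) * (\<Prod>i\<in>?U - S. ?x p i)))"
    by (rule sum.swap)
  also have "\<dots> = (\<Sum>S\<in>Pow ?U.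
      monom ((- 1) ^ card S * principal_minor (\<lambda>i j. A $$ (i, j)) S) (n - card S))"
    by (intro sum.cong summand) auto
  finally show ?thesis .
qed

lemma coeff_char_poly:
  assumes A: "A \<in> carrier_mat n n" and k: "k \<le> n"
  shows "coeff (char_poly A) (n - k) =
    (- 1) ^ k * (\<Sum>S | S \<subseteq> {0..<n} \<and> card S = k. principal_minor (\<lambda>i j. A $$ (i, j)) S)"
proof -
  let ?m = "principal_minor (\<lambda>i j. A $$ (i, j))"
  have "n - card S = n - k \<longleftrightarrow> card S = k" if "S \<subseteq> {0..<n}" for S
    using k card_mono[OF _ that] by auto
  then have "coeff (char_poly A) (n - k) =
      (\<Sum>S\<in>Pow {0..<n}. if card S = k then (- 1) ^ k * ?m S else 0)"
    unfolding char_poly_principal_minors[OF A] coeff_sum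
    by (intro sum.cong) auto
  also have "\<dots> = (\<Sum>S | S \<subseteq> {0..<n} \<and> card S = k. (- 1) ^ k * ?m S)"
    by (simp add: sum.If_cases Pow_def Int_def conj_commute)
  finally show ?thesis by (simp add: sum_distrib_left)
qed

lemma cospectral_iff_char_poly:
  assumes "A \<in> carrier_mat n n" "B \<in> carrier_mat n n"
  shows "cospectral A B \<longleftrightarrow> char_poly A = char_poly B"
proof -
  have "char_poly M = (\<Prod>x\<in>#eigenvalue_mset M. [:- x, 1:])" if "M \<in> carrier_mat n n" for M
    using degree_monic_char_poly[OF that] complex_poly_decompose_multiset[of "char_poly M"]
    by (simp add: eigenvalue_mset_def)
  then show ?thesis
    using assms unfolding cospectral_def by (metis eigenvalue_mset_def)
qed

lemma cospectral_iff_principal_minors: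
  assumes A: "A \<in> carrier_mat n n" and B: "B \<in> carrier_mat n n"
  shows "cospectral A B \<longleftrightarrow>
    (\<forall>k. (\<Sum>S | S \<subseteq> {0..<n} \<and> card S = k. principal_minor (\<lambda>i j. A $$ (i, j)) S) =
         (\<Sum>S | S \<subseteq> {0..<n} \<and> card S = k. principal_minor (\<lambda>i j. B $$ (i, j)) S))"
    (is "_ \<longleftrightarrow> (\<forall>k. ?E A k = ?E B k)")
proof
  assume "cospectral A B"
  then have eq: "char_poly A = char_poly B" using assms by (simp add: cospectral_iff_char_poly)
  show "\<forall>k. ?E A k = ?E B k"
  proof
    fix k
    show "?E A k = ?E B k"
    proof (cases "k \<le> n")
      case True
      show ?thesis
        using coeff_char_poly[OF A True] coeff_char_poly[OF B True] eq by simp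
    next
      case False
      then have "{S. S \<subseteq> {0..<n} \<and> card S = k} = {}"
        using card_mono[of "{0..<n}"] by fastforce
      then show ?thesis by (simp only: sum.empty)
    qed
  qed
next
  assume eq: "\<forall>k. ?E A k = ?E B k"
  have "coeff (char_poly A) i = coeff (char_poly B) i" for i
  proof (cases "i \<le> n")
    case True
    then show ?thesis
      using coeff_char_poly[OF A, of "n - i"] coeff_char_poly[OF B, of "n - i"] eq by simp
  next
    case False
    then show ?thesis
      using degree_monic_char_poly[OF A] degree_monic_char_poly[OF B] by (simp add: coeff_eq_0)
  qed
  then show "cospectral A B" using assms by (simp add: cospectral_iff_char_poly poly_eq_iff)
qed

section \<open>Graph cycles and cyclic permutations\<close>

text \<open>The arcs of a graph cycle with vertex list \<open>us\<close> are the pairs of a vertex and its image under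
  the cyclic permutation given by \<open>us\<close>, so the gain of the cycle is the weight of the permutation.\<close>

lemma zip_rotate1_cycle:
  assumes "distinct us"
  shows "zip us (rotate1 us) = map (\<lambda>i. (i, cycle_of_list us i)) us"
proof -
  have "rotate1 us = map (cycle_of_list us) us"
    using cyclic_rotation[OF assms, of 1] by simp
  then show ?thesis by (simp add: zip_map2 zip_same_conv_map)
qed

lemma re_gain_cycle_of_list:
  assumes "distinct us"
  shows "re_gain A (zip us (rotate1 us)) =
    cycle_re (\<lambda>i j. A $$ (i, j)) (set us) (cycle_of_list us)"
  using assms
  by (simp add: re_gain_def cycle_gain_def cycle_re_def zip_rotate1_cycle o_def
      prod.distinct_set_conv_list)

lemma cyclic_perm_ucycle:
  assumes A: "A \<in> herm_gain_mats n \<Gamma>" and T: "T \<subseteq> {0..<n}" "3 \<le> card T"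
    and c: "c \<in> cyclic_perms T" and nz: "\<forall>i\<in>T. A $$ (i, c i) \<noteq> 0"
  obtains C where "ucycle (graph_of_mat A) C"
    "\<And>M. re_gain M C = cycle_re (\<lambda>i j. M $$ (i, j)) T c"
proof -
  have "finite T" using T(1) finite_subset by blast
  then obtain us where us: "distinct us" "set us = T" "c = cycle_of_list us"
    using cyclic_permsE[OF c] by blast
  have cT: "c i \<in> T" if "i \<in> T" for i
    using c that by (simp add: cyclic_perms_def permutes_in_image)
  have "3 \<le> length us" using us T(2) distinct_card by metis
  moreover have "\<forall>(u, v)\<in>set (zip us (rotate1 us)). u < n \<and> v < n \<and> A $$ (u, v) \<noteq> 0"
  proof -
    have "\<forall>i\<in>T. i < n \<and> c i < n \<and> A $$ (i, c i) \<noteq> 0"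
      using nz T(1) cT by fastforce
    then show ?thesis using us by (auto simp: zip_rotate1_cycle)
  qed
  ultimately have "ucycle (graph_of_mat A) (zip us (rotate1 us))"
    using us(1) ucycle_iff[OF A] by blast
  then show thesis
    by (rule that) (simp add: re_gain_cycle_of_list[OF us(1)] us(2,3))
qed

lemma ucycle_cyclic_perm:
  assumes A: "A \<in> herm_gain_mats n \<Gamma>" and C: "ucycle (graph_of_mat A) C"
  obtains T c where "T \<subseteq> {0..<n}" "c \<in> cyclic_perms T"
    "\<And>M. re_gain M C = cycle_re (\<lambda>i j. M $$ (i, j)) T c"
proof -
  obtain us where us: "C = zip us (rotate1 us)" "distinct us" "3 \<le> length us"
    "\<forall>(u, v)\<in>set C. u < n \<and> v < n \<and> A $$ (u, v) \<noteq> 0"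
    using C ucycle_iff[OF A] by blast
  have "set us \<subseteq> {0..<n}" using us by (auto simp: zip_rotate1_cycle)
  moreover have "cycle_of_list us \<in> cyclic_perms (set us)"
    using us by (intro cycle_of_list_in_cyclic_perms) auto
  ultimately show thesis
    by (rule that) (simp add: us(1) re_gain_cycle_of_list[OF us(2)])
qed

lemma gain_set_cmod:
  "gain_set \<Gamma> \<Longrightarrow> z \<in> \<Gamma> \<Longrightarrow> z \<noteq> 0 \<Longrightarrow> cmod z = 1"
  unfolding gain_set_def by (auto dest: subgroup.mem_carrier)

text \<open>A nonzero weight on a singleton would need a nonzero diagonal entry.  On two vertices the
  weight is an entry of modulus one times its conjugate.\<close>

lemma cycle_re_short:
  assumes \<Gamma>: "gain_set \<Gamma>" and A: "A \<in> herm_gain_mats n \<Gamma>"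
    and T: "T \<subseteq> {0..<n}" "card T < 3" and c: "c \<in> cyclic_perms T"
    and nz: "\<forall>i\<in>T. A $$ (i, c i) \<noteq> 0"
  shows "cycle_re (\<lambda>i j. A $$ (i, j)) T c = 1"
proof -
  have fin: "finite T" using T(1) finite_subset by blast
  obtain us where us: "distinct us" "set us = T" "c = cycle_of_list us"
    using cyclic_permsE[OF c fin] .
  have len: "length us < 3" using us T(2) distinct_card by metis
  have "us \<noteq> []" using c us(2) by (auto simp: cyclic_perms_def cyclic_on_def)
  then consider u where "us = [u]" | u v where "us = [u, v]"
    using len by (cases us rule: remdups_adj.cases) (simp, blast, fastforce)
  then show ?thesis
  proof cases
    case (1 u)
    then have "A $$ (u, u) \<noteq> 0" "u < n" using us nz T by auto
    then show ?thesis using A by (auto simp: herm_gain_mats_def)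
  next
    case (2 u v)
    then have uv: "u < n" "v < n" "u \<noteq> v" "A $$ (u, v) \<noteq> 0" using us nz T by auto
    then have "cmod (A $$ (u, v)) = 1"
      using A gain_set_cmod[OF \<Gamma>] by (auto simp: herm_gain_mats_def)
    moreover have "A $$ (v, u) = cnj (A $$ (u, v))"
    proof -
      have "A \<in> carrier_mat n n" "hermitian_mat A" using A by (auto simp: herm_gain_mats_def)
      then show ?thesis using uv(1,2) hermitian_mat_iff by blast
    qed
    moreover have "cycle_re (\<lambda>i j. A $$ (i, j)) T c = Re (A $$ (u, v) * A $$ (v, u))"
      using 2 us uv by (auto simp: cycle_re_def)
    ultimately show ?thesis by (simp flip: complex_norm_square)
  qed
qed

theorem theorem2p12:
  fixes \<Gamma> :: "complex set" and n :: nat and A B :: "complex mat"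
    and G :: "nat pair_pre_digraph"
  assumes "gain_set \<Gamma>"
    and "A \<in> herm_gain_mats n \<Gamma>" and "B \<in> herm_gain_mats n \<Gamma>"
    and "graph_of_mat A = G" and "graph_of_mat B = G"
    and "\<And>C. ucycle G C \<Longrightarrow> re_gain A C \<le> re_gain B C"
  shows "cospectral A B \<longleftrightarrow> (\<forall>C. ucycle G C \<longrightarrow> re_gain A C = re_gain B C)"
proof -
  let ?a = "\<lambda>i j. A $$ (i, j)" and ?b = "\<lambda>i j. B $$ (i, j)" and ?U = "{0..<n}"
  have A: "A \<in> carrier_mat n n" and B: "B \<in> carrier_mat n n"
    and herm: "hermitian_mat A" "hermitian_mat B"
    using assms(2,3) by (auto simp: herm_gain_mats_def)
  have supp: "A $$ (i, j) = 0 \<longleftrightarrow> B $$ (i, j) = 0" if "i < n" "j < n" for i j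
  proof -
    have "parcs (graph_of_mat A) = parcs (graph_of_mat B)" using assms(4,5) by simp
    then show ?thesis using A B that by (auto simp: graph_of_mat_def set_eq_iff)
  qed
  have dichotomy: "cycle_re ?a T c = cycle_re ?b T c \<or>
      (\<exists>C. ucycle G C \<and> re_gain A C = cycle_re ?a T c \<and> re_gain B C = cycle_re ?b T c)"
    if T: "T \<subseteq> ?U" and c: "c \<in> cyclic_perms T" for T c
  proof (cases "\<forall>i\<in>T. A $$ (i, c i) \<noteq> 0")
    case True
    have cT: "c i \<in> T" if "i \<in> T" for i
      using c that by (simp add: cyclic_perms_def permutes_in_image)
    have True': "\<forall>i\<in>T. B $$ (i, c i) \<noteq> 0"
    proof
      fix i assume "i \<in> T"
      moreover from this have "i < n" "c i < n" using T cT by fastforce+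
      ultimately show "B $$ (i, c i) \<noteq> 0" using True supp by blast
    qed
    show ?thesis
    proof (cases "card T < 3")
      case short: True
      then show ?thesis
        using cycle_re_short[OF assms(1,2) T short c True]
          cycle_re_short[OF assms(1,3) T short c True'] by simp
    next
      case False
      then have long: "3 \<le> card T" by simp
      obtain C where "ucycle (graph_of_mat A) C"
        "\<And>M. re_gain M C = cycle_re (\<lambda>i j. M $$ (i, j)) T c"
        using cyclic_perm_ucycle[OF assms(2) T long c True] by blast
      then show ?thesis unfolding assms(4) by blast
    qed
  next
    case False
    then obtain i where i: "i \<in> T" "A $$ (i, c i) = 0" by blast
    have fin: "finite T" using T finite_subset by blast
    have "c i \<in> T" using c i by (simp add: cyclic_perms_def permutes_in_image)
    then have "i < n" "c i < n" using i T by fastforce+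
    then have "B $$ (i, c i) = 0" using i supp by blast
    then have "(\<Prod>i\<in>T. A $$ (i, c i)) = 0" "(\<Prod>i\<in>T. B $$ (i, c i)) = 0"
      using i fin by (auto intro: prod_zero)
    then show ?thesis by (simp add: cycle_re_def)
  qed
  have "cospectral A B \<longleftrightarrow>
      (\<forall>k. (\<Sum>S | S \<subseteq> ?U \<and> card S = k. principal_minor ?a S) =
           (\<Sum>S | S \<subseteq> ?U \<and> card S = k. principal_minor ?b S))"
    by (rule cospectral_iff_principal_minors[OF A B])
  also have "\<dots> \<longleftrightarrow> (\<forall>T\<subseteq>?U. \<forall>c\<in>cyclic_perms T. cycle_re ?a T c = cycle_re ?b T c)"
  proof (rule sums_of_principal_minors_eq_iff)
    fix T c assume "T \<subseteq> ?U" "c \<in> cyclic_perms T"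
    from dichotomy[OF this] show "cycle_re ?a T c \<le> cycle_re ?b T c"
      by (metis assms(6) order_refl)
  next
    fix i j assume "i \<in> ?U" "j \<in> ?U"
    then have "i < n" "j < n" by auto
    then show "A $$ (i, j) = cnj (A $$ (j, i))" "B $$ (i, j) = cnj (B $$ (j, i))"
      using herm hermitian_mat_iff[OF A] hermitian_mat_iff[OF B] by blast+
  qed simp
  also have "\<dots> \<longleftrightarrow> (\<forall>C. ucycle G C \<longrightarrow> re_gain A C = re_gain B C)"
  proof (intro iffI allI impI ballI)
    fix C assume eq: "\<forall>T\<subseteq>?U. \<forall>c\<in>cyclic_perms T. cycle_re ?a T c = cycle_re ?b T c"
      and "ucycle G C"
    then obtain T c where T: "T \<subseteq> ?U" "c \<in> cyclic_perms T"
      and re: "\<And>M. re_gain M C = cycle_re (\<lambda>i j. M $$ (i, j)) T c"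
      using ucycle_cyclic_perm[OF assms(2), unfolded assms(4)] by blast
    show "re_gain A C = re_gain B C"
      unfolding re using eq T by blast
  next
    fix T c assume eq: "\<forall>C. ucycle G C \<longrightarrow> re_gain A C = re_gain B C"
      and T: "T \<subseteq> ?U" "c \<in> cyclic_perms T"
    from dichotomy[OF T] show "cycle_re ?a T c = cycle_re ?b T c"
      using eq by metis
  qed
  finally show ?thesis .
qed

end
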